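(* Let $A\in M_{s,n}(\mathbb{Z})$ be an integer matrix whose entries have greatest common divisor $1$, let $\vec p\in\mathbb{Z}^n$, and consider the intersection $\mathcal H=\{\vec x\in\mathbb{R}^n: A\vec x=A\vec p\}$ of the $s$ hyperplanes given by the rows of this system. Let $U\in GL_s(\mathbb{Z})$ and $V\in GL_n(\mathbb{Z})$ be such that $UAV=D$ is the Smith Normal Form of $A$, let $m=\mathrm{rank}(A)$, and write $V^{-1}\vec p=(p_1',\dots,p_n')$. Then the asymptotic density of visible points on $\mathcal H$ exists and equals \[\prod_{p\mid \gcd(p_1',\dots,p_m')}\left(1-\frac{1}{p^{n-m}}\right),\] the product being over primes $p$ dividing $\gcd(p_1',\dots,p_m')$ (over all primes if this gcd is $0$).
   Context: The Smith Normal Form of $A$ is the $s\times n$ matrix $D$ with zero off-diagonal entries and diagonal entries $d_1,d_2,\dots$ (the invariant factors) satisfying $d_i\mid d_{i+1}$, $d_1\cdots d_i=\gcd$ of the $i\times i$ minors of $A$, and $d_i=0$ for $i>\mathrm{rank}(A)$. A lattice point $\vec x\in\mathbb{Z}^n$ is visible if $\gcd(x_1,\dots,x_n)=1$. For $\Delta\subseteq\mathbb{R}^n$ and $r>0$, let $\Delta_1(r)=\Delta\cap[-r,r]^n\cap\mathbb{Z}^n$ and let $\Delta_0(r)$ be the set of visible points in $\Delta_1(r)$. The asymptotic density of visible points in $\Delta$ is $\rho(\Delta)=\lim_{r\to\infty}|\Delta_0(r)|/|\Delta_1(r)|$, when this limit exists. *)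

theory Defs
  imports
    "HOL-Computational_Algebra.Primes"
    "Jordan_Normal_Form.DL_Rank"
    "Jordan_Normal_Form.DL_Submatrix"
begin

text \<open>All matrix and vector indices start at 0, so the invariant factor written \<open>d_i\<close> with
  \<open>i \<ge> 1\<close> is the entry \<open>(i - 1, i - 1)\<close>, and the first \<open>m\<close> coordinates are those with
  index \<open>i < m\<close>.\<close>

abbreviation real_vec :: "int vec \<Rightarrow> real vec" where
  "real_vec \<equiv> map_vec real_of_int"

abbreviation real_mat :: "int mat \<Rightarrow> real mat" where
  "real_mat \<equiv> map_mat real_of_int"

definition GL :: "nat \<Rightarrow> int mat set" where
  "GL n = {U \<in> carrier_mat n n. invertible_mat U}"

definition int_rank :: "int mat \<Rightarrow> nat" where
  "int_rank A = vec_space.rank (dim_row A) (map_mat rat_of_int A)"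

definition minors :: "nat \<Rightarrow> int mat \<Rightarrow> int set" where
  "minors k A = {det (submatrix A I J) | I J.
     I \<subseteq> {..<dim_row A} \<and> J \<subseteq> {..<dim_col A} \<and> card I = k \<and> card J = k}"

text \<open>\<open>Gcd\<close> on the integers is nonnegative, so the condition on the determinantal divisors also
  fixes the signs of the invariant factors.\<close>

definition is_smith_normal_form :: "int mat \<Rightarrow> int mat \<Rightarrow> bool" where
  "is_smith_normal_form A D \<longleftrightarrow>
     D \<in> carrier_mat (dim_row A) (dim_col A) \<and>
     diagonal_mat D \<and>
     (\<forall>i. Suc i < min (dim_row A) (dim_col A) \<longrightarrow> D $$ (i, i) dvd D $$ (Suc i, Suc i)) \<and>
     (\<forall>k. 1 \<le> k \<and> k \<le> min (dim_row A) (dim_col A) \<longrightarrow>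
        (\<Prod>i<k. D $$ (i, i)) = Gcd (minors k A)) \<and>
     (\<forall>i < min (dim_row A) (dim_col A). int_rank A \<le> i \<longrightarrow> D $$ (i, i) = 0)"

definition visible :: "int vec \<Rightarrow> bool" where
  "visible x \<longleftrightarrow> Gcd {x $ i | i. i < dim_vec x} = 1"

definition lattice_points :: "nat \<Rightarrow> real vec set \<Rightarrow> real \<Rightarrow> int vec set" where
  "lattice_points n \<Delta> r =
     {x \<in> carrier_vec n. real_vec x \<in> \<Delta> \<and> (\<forall>i<n. real_vec x $ i \<in> {-r..r})}"

definition visible_points :: "nat \<Rightarrow> real vec set \<Rightarrow> real \<Rightarrow> int vec set" where
  "visible_points n \<Delta> r = {x \<in> lattice_points n \<Delta> r. visible x}"

definition has_visible_density :: "nat \<Rightarrow> real vec set \<Rightarrow> real \<Rightarrow> bool" where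
  "has_visible_density n \<Delta> \<rho> \<longleftrightarrow>
     ((\<lambda>r. real (card (visible_points n \<Delta> r)) / real (card (lattice_points n \<Delta> r)))
        \<longlongrightarrow> \<rho>) at_top"

definition hyperplane_intersection :: "nat \<Rightarrow> int mat \<Rightarrow> int vec \<Rightarrow> real vec set" where
  "hyperplane_intersection n A p =
     {x \<in> carrier_vec n. real_mat A *\<^sub>v x = real_mat A *\<^sub>v real_vec p}"

text \<open>The product of \<open>1 - 1 / p ^ k\<close> over the primes \<open>p\<close> dividing \<open>g\<close>, as the limit of its
  partial products. For \<open>g \<noteq> 0\<close> it is a finite product; for \<open>g = 0\<close> it ranges over all primes.
  The library's \<open>prodinf\<close> is not suitable: for \<open>g = 0\<close> and \<open>k = 1\<close> the partial products tend
  to \<open>0\<close> although no factor vanishes, which \<open>has_prod\<close> does not count as convergence.\<close>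

definition euler_product :: "int \<Rightarrow> nat \<Rightarrow> real" where
  "euler_product g k =
     lim (\<lambda>N. \<Prod>p | prime p \<and> p \<le> N \<and> int p dvd g. 1 - 1 / real p ^ k)"

lemma euler_product_LIMSEQ:
  "(\<lambda>N. \<Prod>p | prime p \<and> p \<le> N \<and> int p dvd g. 1 - 1 / real p ^ k) \<longlonglongrightarrow> euler_product g k"
proof -
  let ?S = "\<lambda>N. {p::nat. prime p \<and> p \<le> N \<and> int p dvd g}"
  let ?f = "\<lambda>p::nat. 1 - 1 / real p ^ k"
  have fin: "finite (?S N)" for N
    by (rule finite_subset[of _ "{..N}"]) auto
  have bnd: "0 \<le> ?f p \<and> ?f p \<le> 1" if "prime p" for p
    using prime_ge_1_nat[OF that] by (simp add: divide_simps)
  have "decseq (\<lambda>N. prod ?f (?S N))"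
  proof (rule antimonoI)
    fix M N :: nat assume "M \<le> N"
    then have sub: "?S M \<subseteq> ?S N" by auto
    have "prod ?f (?S N) = prod ?f (?S N - ?S M) * prod ?f (?S M)"
      by (rule prod.subset_diff[OF sub fin])
    also have "\<dots> \<le> 1 * prod ?f (?S M)"
      using bnd by (intro mult_right_mono prod_le_1 prod_nonneg) auto
    finally show "prod ?f (?S N) \<le> prod ?f (?S M)" by simp
  qed
  moreover have "0 \<le> prod ?f (?S N)" for N
    using bnd by (intro prod_nonneg) auto
  ultimately obtain L where "(\<lambda>N. prod ?f (?S N)) \<longlonglongrightarrow> L"
    using decseq_convergent[of "\<lambda>N. prod ?f (?S N)" 0] by blast
  then show ?thesis
    unfolding euler_product_def by (simp add: limI)
qed

lemma euler_product_finite: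
  assumes "g \<noteq> 0"
  shows "euler_product g k = (\<Prod>p | prime p \<and> int p dvd g. 1 - 1 / real p ^ k)"
proof -
  have "p \<le> nat \<bar>g\<bar>" if "int p dvd g" for p
    using dvd_imp_le_int[OF assms that] by simp
  then have "\<forall>N \<ge> nat \<bar>g\<bar>. {p. prime p \<and> p \<le> N \<and> int p dvd g} = {p. prime p \<and> int p dvd g}"
    using le_trans by blast
  then have "\<forall>\<^sub>F N in sequentially.
      (\<Prod>p | prime p \<and> p \<le> N \<and> int p dvd g. 1 - 1 / real p ^ k)
        = (\<Prod>p | prime p \<and> int p dvd g. 1 - 1 / real p ^ k)"
    unfolding eventually_sequentially
    by (intro exI[of _ "nat \<bar>g\<bar>"] allI impI prod.cong) auto
  then have "(\<lambda>N. \<Prod>p | prime p \<and> p \<le> N \<and> int p dvd g. 1 - 1 / real p ^ k)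
      \<longlonglongrightarrow> (\<Prod>p | prime p \<and> int p dvd g. 1 - 1 / real p ^ k)"
    by (rule tendsto_eventually)
  then show ?thesis
    using euler_product_LIMSEQ LIMSEQ_unique by blast
qed

end

theory Submission
  imports Defs
begin

text \<open>In the coordinates \<open>y = V\<^sup>-\<^sup>1 x\<close> the system reads \<open>D y = D p'\<close>, and as the first \<open>m\<close> invariant
  factors are nonzero and the others vanish, the lattice points of the hyperplane intersection are
  the \<open>V y\<close> with \<open>y = (p'_1, \<dots>, p'_m, t)\<close> and \<open>t\<close> an arbitrary integer vector of length
  \<open>k = n - m\<close>. Since \<open>V\<close> is unimodular, \<open>V y\<close> is visible iff no prime divisor of
  \<open>g = gcd(p'_1, \<dots>, p'_m)\<close> divides \<open>t\<close>.

  Let \<open>N R\<close> be the number of \<open>t\<close> for which \<open>V y\<close> lies in the box of radius \<open>R\<close>. It is at least of order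
  \<open>R ^ k\<close>, while each of the boundedly many slices that make up the shell between radii \<open>R\<close> and \<open>R + h\<close>
  contains \<open>O(R ^ (k - 1))\<close> points, so \<open>N (R + h) / N R\<close> tends to 1. Translating residue classes
  modulo \<open>d\<close> into each other then shows that multiples of \<open>d\<close> have density \<open>1 / d ^ k\<close>, and
  inclusion-exclusion gives the Euler product over any finite set of primes. For \<open>g = 0\<close> and \<open>k \<ge> 2\<close>,
  the points divisible by some \<open>d > P\<close> have upper density \<open>O(1 / P)\<close>; for \<open>g = 0\<close> and \<open>k \<le> 1\<close> there are
  boundedly many visible points, and the Euler product is 0.\<close>

section \<open>Vanishing Euler products\<close>

text \<open>Induction on \<open>N\<close>: passing to the next logarithm adds
  \<open>ln (1 + 1 / Suc N)\<close>, which is at most the new summand.\<close>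

lemma ln_le_harmonic_sum: "ln (real N + 1) \<le> (\<Sum>n=1..N. 1 / real n)"
proof (induction N)
  case (Suc N)
  have "ln (real (Suc N) + 1) = ln (real (Suc N)) + ln (1 + 1 / real (Suc N))"
  proof -
    have "real (Suc N) + 1 = real (Suc N) * (1 + 1 / real (Suc N))"
      by (simp add: distrib_left)
    also have "ln \<dots> = ln (real (Suc N)) + ln (1 + 1 / real (Suc N))"
      by (rule ln_mult_pos) (simp_all add: add_pos_nonneg)
    finally show ?thesis .
  qed
  also have "\<dots> \<le> ln (real N + 1) + 1 / real (Suc N)"
    using ln_add_one_self_le_self[of "1 / real (Suc N)"] by (simp add: add.commute)
  finally show ?case
    using Suc by simp
qed simp

text \<open>Expanding the inverse Euler factors as geometric series produces every \<open>1 / n\<close> with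
  \<open>n \<le> N\<close>, by unique factorization.\<close>

lemma harmonic_sum_mult_prime_prod_le:
  "(\<Prod>p | prime p \<and> p \<le> N. 1 - 1 / real p) * (\<Sum>n=1..N. 1 / real n) \<le> 1"
proof -
  let ?P = "{p. prime p \<and> p \<le> N}"
  have fin: "finite ?P"
    by (rule finite_subset[of _ "{..N}"]) auto
  \<comment> \<open>\<open>F\<close> holds the exponent vectors produced by multiplying out the
    truncated geometric series. The cutoff \<open>N\<close> loses no \<open>n \<le> N\<close>, since
    an exponent \<open>e\<close> of \<open>p\<close> in \<open>n\<close> satisfies
    \<open>e < p ^ e \<le> n\<close>.\<close>
  define F where "F = ?P \<rightarrow>\<^sub>E {..N}"
  define h where "h n = restrict (\<lambda>p. multiplicity p n) ?P" for n :: nat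
  have inv_h: "(\<Prod>p\<in>?P. p ^ h n p) = n" if n: "n \<in> {1..N}" for n
  proof -
    have sub: "prime_factors n \<subseteq> ?P"
      using n by (auto simp: prime_factors_dvd dest!: dvd_imp_le)
    have "(\<Prod>p\<in>?P. p ^ h n p) = (\<Prod>p\<in>?P. p ^ multiplicity p n)"
      by (rule prod.cong) (auto simp: h_def)
    also have "\<dots> = (\<Prod>p\<in>prime_factors n. p ^ multiplicity p n)"
      using sub fin n
      by (intro prod.mono_neutral_right) (auto simp: prime_factors_multiplicity)
    also have "\<dots> = n"
      using n prime_factorization_nat[of n] by simp
    finally show ?thesis .
  qed
  have h_F: "h n \<in> F" if n: "n \<in> {1..N}" for n
  proof -
    have "multiplicity p n \<le> N" if p: "prime p" for p
    proof -
      have "p ^ multiplicity p n \<le> n"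
        using n by (intro dvd_imp_le multiplicity_dvd) auto
      moreover have "multiplicity p n < p ^ multiplicity p n"
        using prime_gt_1_nat[OF p] by (simp add: power_gt_expt)
      ultimately show ?thesis
        using n by simp
    qed
    then show ?thesis
      by (auto simp: F_def h_def)
  qed
  have inj: "inj_on h {1..N}"
    by (rule inj_on_inverseI[where g = "\<lambda>f. \<Prod>p\<in>?P. p ^ f p"]) (rule inv_h)
  have "(\<Sum>n=1..N. 1 / real n) = (\<Sum>n=1..N. 1 / real (\<Prod>p\<in>?P. p ^ h n p))"
    by (rule sum.cong) (simp_all only: inv_h)
  also have "\<dots> = (\<Sum>f\<in>h ` {1..N}. 1 / real (\<Prod>p\<in>?P. p ^ f p))"
    by (subst sum.reindex[OF inj]) simp
  also have "\<dots> \<le> (\<Sum>f\<in>F. 1 / real (\<Prod>p\<in>?P. p ^ f p))"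
  proof (rule sum_mono2)
    show "finite F"
      unfolding F_def using fin by (intro finite_PiE) auto
    show "h ` {1..N} \<subseteq> F"
      using h_F by blast
  qed (simp add: prod_nonneg)
  also have "\<dots> = (\<Sum>f\<in>F. \<Prod>p\<in>?P. (1 / real p) ^ f p)"
    by (simp add: power_one_over prod_dividef)
  also have "\<dots> = (\<Prod>p\<in>?P. \<Sum>j\<le>N. (1 / real p) ^ j)"
    unfolding F_def by (rule prod_sum_PiE[symmetric]) (use fin in auto)
  finally have harm_le: "(\<Sum>n=1..N. 1 / real n) \<le> (\<Prod>p\<in>?P. \<Sum>j\<le>N. (1 / real p) ^ j)" .
  have bnd: "0 \<le> 1 - 1 / real p" if "prime p" for p :: nat
    using prime_ge_1_nat[OF that] by (simp add: divide_simps)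
  have "(\<Prod>p\<in>?P. 1 - 1 / real p) * (\<Sum>n=1..N. 1 / real n)
      \<le> (\<Prod>p\<in>?P. 1 - 1 / real p) * (\<Prod>p\<in>?P. \<Sum>j\<le>N. (1 / real p) ^ j)"
    by (intro mult_left_mono harm_le prod_nonneg) (use bnd in auto)
  also have "\<dots> = (\<Prod>p\<in>?P. (1 - 1 / real p) * (\<Sum>j\<le>N. (1 / real p) ^ j))"
    by (simp add: prod.distrib)
  also have "\<dots> = (\<Prod>p\<in>?P. 1 - (1 / real p) ^ Suc N)"
    by (rule prod.cong) (simp_all only: sum_gp_basic)
  also have "\<dots> \<le> 1"
  proof (rule prod_le_1)
    fix p assume "p \<in> ?P"
    then have "1 \<le> real p"
      using prime_ge_1_nat[of p] by simp
    then show "0 \<le> 1 - (1 / real p) ^ Suc N \<and> 1 - (1 / real p) ^ Suc N \<le> 1"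
      using power_le_one[of "1 / real p" "Suc N"] by simp
  qed
  finally show ?thesis .
qed

text \<open>For \<open>k \<le> 1\<close> every factor is at most \<open>1 - 1 / p\<close>, so the
  partial product up to \<open>N\<close> is at most the reciprocal of the harmonic sum, hence at
  most \<open>1 / ln (N + 1)\<close>.\<close>

lemma euler_product_0_eq_0:
  assumes "k \<le> 1"
  shows "euler_product 0 k = 0"
proof (rule LIMSEQ_unique[OF euler_product_LIMSEQ])
  let ?P = "\<lambda>N. {p. prime p \<and> p \<le> N \<and> int p dvd 0}"
  have bnd: "0 \<le> 1 - 1 / real p ^ k \<and> 1 - 1 / real p ^ k \<le> 1 - 1 / real p"
    if "prime p" for p :: nat
    using prime_ge_1_nat[OF that] assms by (cases "k = 0") (auto simp: divide_simps le_Suc_eq)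
  have nonneg: "0 \<le> (\<Prod>p\<in>?P N. 1 - 1 / real p ^ k)" for N
    using bnd by (intro prod_nonneg) auto
  have le: "(\<Prod>p\<in>?P N. 1 - 1 / real p ^ k) \<le> 1 / ln (real N + 1)" if "N \<ge> 1" for N
  proof -
    have "(\<Prod>p\<in>?P N. 1 - 1 / real p ^ k) \<le> (\<Prod>p | prime p \<and> p \<le> N. 1 - 1 / real p)"
      using bnd by (simp only: dvd_0_right simp_thms) (intro prod_mono, blast)
    also have "\<dots> \<le> 1 / ln (real N + 1)"
    proof -
      have "(\<Prod>p | prime p \<and> p \<le> N. 1 - 1 / real p) * ln (real N + 1)
          \<le> (\<Prod>p | prime p \<and> p \<le> N. 1 - 1 / real p) * (\<Sum>n=1..N. 1 / real n)"
      proof (intro mult_left_mono ln_le_harmonic_sum prod_nonneg ballI)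
        fix p assume "p \<in> {p. prime p \<and> p \<le> N}"
        then have "prime p" by simp
        from bnd[OF this] show "0 \<le> 1 - 1 / real p" by linarith
      qed
      also have "\<dots> \<le> 1"
        by (rule harmonic_sum_mult_prime_prod_le)
      finally show ?thesis
        using that by (simp add: pos_le_divide_eq)
    qed
    finally show ?thesis .
  qed
  have "filterlim (\<lambda>N. ln (real N + 1)) at_top sequentially"
    by (rule filterlim_compose[OF ln_at_top filterlim_at_top_mono[OF filterlim_real_sequentially]]) simp
  then have "(\<lambda>N. 1 / ln (real N + 1)) \<longlonglongrightarrow> 0"
    using tendsto_inverse_0_at_top by (simp add: inverse_eq_divide)
  then show "(\<lambda>N. \<Prod>p\<in>?P N. 1 - 1 / real p ^ k) \<longlonglongrightarrow> 0"
    by (rule tendsto_sandwich[rotated 2, OF tendsto_const])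
       (use nonneg le in \<open>auto simp: eventually_sequentially\<close>)
qed

section \<open>Counting in affine slices\<close>

text \<open>Splits coprimality into one condition per prime, the form a sieve can treat.\<close>

lemma gcd_int_eq_1_iff:
  fixes g h :: int
  shows "gcd g h = 1 \<longleftrightarrow> (\<forall>q. prime q \<and> int q dvd g \<longrightarrow> \<not> int q dvd h)"
proof
  assume "gcd g h = 1"
  then have "int q dvd g \<Longrightarrow> int q dvd h \<Longrightarrow> q = 1" for q
    using gcd_greatest[of "int q" g h] by simp
  then show "\<forall>q. prime q \<and> int q dvd g \<longrightarrow> \<not> int q dvd h"
    using not_prime_1 by blast
next
  assume no_prime: "\<forall>q. prime q \<and> int q dvd g \<longrightarrow> \<not> int q dvd h"
  show "gcd g h = 1"
  proof (rule ccontr)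
    assume "gcd g h \<noteq> 1"
    moreover have "gcd g h = int (nat (gcd g h))"
      by simp
    \<comment> \<open>The case of gcd 0 is included: 0 differs from 1 and every prime divides
      it.\<close>
    ultimately have "nat (gcd g h) \<noteq> 1"
      by linarith
    then obtain q where q: "prime q" "q dvd nat (gcd g h)"
      using prime_factor_nat by blast
    then have "int q dvd gcd g h"
      by (simp add: int_dvd_int_iff[symmetric] del: int_dvd_int_iff)
    with no_prime q(1) show False
      by (meson dvd_trans gcd_dvd1 gcd_dvd2)
  qed
qed

lemma sum_inverse_squares_tail:
  assumes "P > 0"
  shows "(\<Sum>d\<in>{P<..S}. 1 / real d ^ 2) \<le> 1 / real P"
proof -
  \<comment> \<open>The extra \<open>- 1 / real S\<close> makes the induction telescope, as
    \<open>1 / (S * (S + 1)) = 1 / S - 1 / (S + 1)\<close>.\<close>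
  have "(\<Sum>d\<in>{P<..S}. 1 / real d ^ 2) \<le> 1 / real P - 1 / real S" if "S \<ge> P"
    using that
  proof (induction S rule: dec_induct)
    case (step S)
    have "{P<..Suc S} = insert (Suc S) {P<..S}"
      using step.hyps by auto
    moreover have "1 / real (Suc S) ^ 2 \<le> 1 / (real S * real (Suc S))"
      using assms step.hyps(1) by (intro divide_left_mono) (auto simp: power2_eq_square)
    moreover have "1 / (real S * real (Suc S)) = 1 / real S - 1 / real (Suc S)"
      using assms step.hyps(1) by (simp add: field_simps)
    ultimately show ?case
      using step.IH by simp
  qed simp
  then show ?thesis
    by (cases "S \<ge> P") (auto intro: order_trans)
qed

text \<open>The points \<open>(a i + (\<Sum>j\<in>I. B i j * t j))\<^sub>i\<close> parametrize the lattice points of the hyperplane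
  intersection. The assumption \<open>coord_bound\<close> expresses that the parametrization has a linear left
  inverse.\<close>

locale affine_slice =
  fixes I :: "'i set" and J :: "'j set" and a :: "'j \<Rightarrow> int" and B :: "'j \<Rightarrow> 'i \<Rightarrow> int" and c :: nat
  assumes finite_I: "finite I" and finite_J: "finite J" and c_pos: "c > 0"
    and coord_bound: "\<And>t R j. \<lbrakk>\<forall>i\<in>J. \<bar>a i + (\<Sum>j\<in>I. B i j * t j)\<bar> \<le> int R; j \<in> I\<rbrakk>
          \<Longrightarrow> \<bar>t j\<bar> \<le> int (c * R)"
begin

definition x :: "('i \<Rightarrow> int) \<Rightarrow> 'j \<Rightarrow> int" where
  "x t i = a i + (\<Sum>j\<in>I. B i j * t j)"

text \<open>Extensional functions represent each integer vector indexed by \<open>I\<close> exactly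
  once, so cardinalities count lattice points.\<close>

definition box :: "nat \<Rightarrow> ('i \<Rightarrow> int) set" where
  "box R = {t \<in> I \<rightarrow>\<^sub>E UNIV. \<forall>i\<in>J. \<bar>x t i\<bar> \<le> int R}"

definition cube :: "nat \<Rightarrow> ('i \<Rightarrow> int) set" where
  "cube S = I \<rightarrow>\<^sub>E {- int S..int S}"

text \<open>A common bound for the constants \<open>\<bar>a i\<bar>\<close> and the row sums of
  \<open>\<bar>B i j\<bar>\<close>; the summand 1 makes it a legitimate divisor.\<close>

definition b :: nat where
  "b = nat (1 + (\<Sum>i\<in>J. \<bar>a i\<bar> + (\<Sum>j\<in>I. \<bar>B i j\<bar>)))"

abbreviation k :: nat where
  "k \<equiv> card I"

lemma b_pos: "b > 0"
  unfolding b_def by (simp add: add_pos_nonneg sum_nonneg)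

lemma
  assumes "i \<in> J"
  shows a_le_b: "\<bar>a i\<bar> \<le> int b" and B_le_b: "(\<Sum>j\<in>I. \<bar>B i j\<bar>) \<le> int b"
proof -
  let ?f = "\<lambda>i. \<bar>a i\<bar> + (\<Sum>j\<in>I. \<bar>B i j\<bar>)"
  have "?f i \<le> sum ?f J"
    using assms finite_J by (intro member_le_sum) (auto intro!: add_nonneg_nonneg sum_nonneg)
  moreover have "int b = 1 + sum ?f J"
    unfolding b_def by (simp add: sum_nonneg)
  moreover have "0 \<le> (\<Sum>j\<in>I. \<bar>B i j\<bar>)"
    by (simp add: sum_nonneg)
  ultimately show "\<bar>a i\<bar> \<le> int b" "(\<Sum>j\<in>I. \<bar>B i j\<bar>) \<le> int b"
    by linarith+
qed

lemma linear_bound: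
  assumes "i \<in> J" and "\<And>j. j \<in> I \<Longrightarrow> \<bar>t j\<bar> \<le> int S"
  shows "\<bar>\<Sum>j\<in>I. B i j * t j\<bar> \<le> int (b * S)"
proof -
  have "\<bar>\<Sum>j\<in>I. B i j * t j\<bar> \<le> (\<Sum>j\<in>I. \<bar>B i j\<bar> * \<bar>t j\<bar>)"
    by (rule order_trans[OF sum_abs]) (simp add: abs_mult)
  also have "\<dots> \<le> (\<Sum>j\<in>I. \<bar>B i j\<bar> * int S)"
    using assms by (intro sum_mono mult_left_mono) auto
  also have "\<dots> = (\<Sum>j\<in>I. \<bar>B i j\<bar>) * int S"
    by (simp add: sum_distrib_right)
  also have "\<dots> \<le> int b * int S"
    using B_le_b[OF assms(1)] by (intro mult_right_mono) auto
  finally show ?thesis by simp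
qed

lemma card_cube: "card (cube S) = (2 * S + 1) ^ k"
  unfolding cube_def using finite_I by (simp add: card_PiE nat_add_distrib nat_mult_distrib)

lemma finite_cube: "finite (cube S)"
  unfolding cube_def using finite_I by (intro finite_PiE) auto

text \<open>Here \<open>coord_bound\<close> enters and makes boxes finite. With
  \<open>cube_subset_box\<close> it traps boxes between cubes of size proportional to the
  radius.\<close>

lemma box_subset_cube: "box R \<subseteq> cube (c * R)"
  using coord_bound unfolding box_def cube_def x_def by (force simp: PiE_iff abs_le_iff)

lemma finite_box: "finite (box R)"
  using box_subset_cube finite_cube finite_subset by blast

lemma box_mono: "R \<le> R' \<Longrightarrow> box R \<subseteq> box R'"
  unfolding box_def by force

lemma cube_subset_box: "cube S \<subseteq> box (b + b * S)"
proof
  fix t assume t: "t \<in> cube S"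
  have "\<bar>x t i\<bar> \<le> int (b + b * S)" if i: "i \<in> J" for i
  proof -
    have "\<bar>\<Sum>j\<in>I. B i j * t j\<bar> \<le> int (b * S)"
      using t by (intro linear_bound i) (force simp: cube_def abs_le_iff PiE_iff)
    with a_le_b[OF i] show ?thesis
      unfolding x_def by (smt (verit) of_nat_add)
  qed
  with t show "t \<in> box (b + b * S)"
    by (auto simp: box_def cube_def PiE_iff)
qed

section \<open>Growth of boxes and thin shells\<close>

lemma card_box_ge:
  assumes "R \<ge> 2 * b"
  shows "(real R / real (2 * b)) ^ k \<le> real (card (box R))"
proof -
  \<comment> \<open>The largest \<open>S\<close> with \<open>b + b * S \<le> R\<close>, so that
    \<open>cube S\<close> still fits into \<open>box R\<close>.\<close>
  define S where "S = (R - b) div b"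
  have le_R: "b + b * S \<le> R"
    using assms times_div_less_eq_dividend[of b "R - b"] unfolding S_def by linarith
  have "R - b < b + S * b"
    unfolding S_def using b_pos dividend_less_div_times by blast
  then have "real R < real (2 * b + S * b)"
    by linarith
  then have "real R / real b < real (2 + S)"
    using b_pos by (simp add: divide_less_eq algebra_simps)
  then have "real R / real (2 * b) \<le> real (2 * S + 1)"
    by (simp add: field_simps)
  then have "(real R / real (2 * b)) ^ k \<le> real (2 * S + 1) ^ k"
    by (intro power_mono) auto
  also have "\<dots> = real (card (cube S))"
    by (simp add: card_cube)
  also have "\<dots> \<le> real (card (box R))"
    using cube_subset_box[of S] box_mono[OF le_R] finite_box by (auto intro!: card_mono)
  finally show ?thesis .
qed

text \<open>On a slice, the coordinate \<open>j\<close> is determined by the remaining ones.\<close>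

lemma card_slice_le:
  assumes "j \<in> I" "B i j \<noteq> 0"
  shows "card {t \<in> cube S. x t i = v} \<le> (2 * S + 1) ^ (k - 1)"
proof -
  let ?T = "(I - {j}) \<rightarrow>\<^sub>E {- int S..int S}"
  have fin: "finite ?T"
    using finite_I by (intro finite_PiE) auto
  have "inj_on (\<lambda>t. restrict t (I - {j})) {t \<in> cube S. x t i = v}"
  proof (rule inj_onI)
    fix t u assume t: "t \<in> {t \<in> cube S. x t i = v}" and u: "u \<in> {t \<in> cube S. x t i = v}"
      and eq: "restrict t (I - {j}) = restrict u (I - {j})"
    have off: "t l = u l" if "l \<in> I - {j}" for l
      using fun_cong[OF eq, of l] that by simp
    have split: "x w i = a i + B i j * w j + (\<Sum>l\<in>I - {j}. B i l * w l)" for w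
      unfolding x_def using assms finite_I by (simp add: sum.remove)
    have "(\<Sum>l\<in>I - {j}. B i l * t l) = (\<Sum>l\<in>I - {j}. B i l * u l)"
      using off by (intro sum.cong) auto
    with t u have "B i j * t j = B i j * u j"
      by (auto simp: split)
    with assms off have "t l = u l" if "l \<in> I" for l
      using that by (cases "l = j") auto
    then show "t = u"
      using t u unfolding cube_def by (blast intro: PiE_ext)
  qed
  then have "card {t \<in> cube S. x t i = v} \<le> card ?T"
    by (rule card_inj_on_le) (use fin in \<open>force simp: cube_def restrict_PiE_iff\<close>)+
  also have "\<dots> = (2 * S + 1) ^ (k - 1)"
    using finite_I assms by (simp add: card_PiE nat_add_distrib nat_mult_distrib)
  finally show ?thesis .
qed

text \<open>Union bound: a point of the shell has a coordinate taking one of the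
  \<open>2 * h\<close> values of absolute value between \<open>R + 1\<close> and
  \<open>R + h\<close>, and \<open>card_slice_le\<close> counts each such slice.\<close>

lemma card_box_shell_le:
  assumes "R \<ge> b"
  shows "card (box (R + h) - box R) \<le> card J * (2 * h) * (2 * (c * (R + h)) + 1) ^ (k - 1)"
proof -
  \<comment> \<open>Only coordinates that depend on \<open>t\<close> can leave the smaller box: a
    constant one equals \<open>a i\<close>, and
    \<open>\<bar>a i\<bar> \<le> b \<le> R\<close>.\<close>
  define J' where "J' = {i\<in>J. \<exists>j\<in>I. B i j \<noteq> 0}"
  define Vs where "Vs = {- int (R + h)..- int R - 1} \<union> {int R + 1..int (R + h)}"
  let ?sl = "\<lambda>(i, v). {t \<in> cube (c * (R + h)). x t i = v}"
  have fJ: "finite J'" "card J' \<le> card J"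
    unfolding J'_def using finite_J by (auto intro: card_mono)
  have fV: "finite Vs" "card Vs \<le> 2 * h"
    unfolding Vs_def using card_Un_le[of "{- int (R + h)..- int R - 1}" "{int R + 1..int (R + h)}"] by auto
  have "box (R + h) - box R \<subseteq> (\<Union>iv\<in>J' \<times> Vs. ?sl iv)"
  proof
    fix t assume t: "t \<in> box (R + h) - box R"
    then obtain i where i: "i \<in> J" "\<bar>x t i\<bar> > int R" "\<bar>x t i\<bar> \<le> int (R + h)"
      by (force simp: box_def not_le)
    have "i \<in> J'"
    proof (rule ccontr)
      assume "i \<notin> J'"
      then have "x t i = a i"
        using i by (auto simp: J'_def x_def)
      with a_le_b[OF i(1)] i assms show False by simp
    qed
    moreover have "x t i \<in> Vs"
      using i by (auto simp: Vs_def)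
    moreover have "t \<in> cube (c * (R + h))"
      using t box_subset_cube by blast
    ultimately show "t \<in> (\<Union>iv\<in>J' \<times> Vs. ?sl iv)"
      by (intro UN_I[of "(i, x t i)"]) auto
  qed
  then have "card (box (R + h) - box R) \<le> card (\<Union>iv\<in>J' \<times> Vs. ?sl iv)"
    using fJ fV finite_cube by (intro card_mono) auto
  also have "\<dots> \<le> (\<Sum>iv\<in>J' \<times> Vs. card (?sl iv))"
    using fJ fV by (intro card_UN_le) auto
  also have "\<dots> \<le> (\<Sum>iv\<in>J' \<times> Vs. (2 * (c * (R + h)) + 1) ^ (k - 1))"
    using card_slice_le by (intro sum_mono) (fastforce simp: J'_def)
  also have "\<dots> = card J' * card Vs * (2 * (c * (R + h)) + 1) ^ (k - 1)"
    by (simp add: card_cartesian_product)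
  also have "\<dots> \<le> card J * (2 * h) * (2 * (c * (R + h)) + 1) ^ (k - 1)"
    using fJ fV by (intro mult_right_mono mult_mono) auto
  finally show ?thesis .
qed

lemma card_box_pos:
  assumes "R \<ge> 2 * b"
  shows "card (box R) > 0"
  using card_box_ge[OF assms] assms b_pos
  by (smt (verit) divide_pos_pos mult_pos_pos of_nat_0_less_iff less_le_trans zero_less_numeral zero_less_power)

lemma card_box_ratio_add: "(\<lambda>R. real (card (box (R + h))) / real (card (box R))) \<longlonglongrightarrow> 1"
proof (cases "k = 0")
  \<comment> \<open>The truncated exponent \<open>k - 1\<close> saves no power of \<open>R\<close>
    here, but the box is a single point once \<open>R \<ge> 2 * b\<close>.\<close>
  case True
  then have "card (box R) = 1" if "R \<ge> 2 * b" for R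
    using card_box_pos[OF that] card_mono[OF finite_cube box_subset_cube, of R] by (simp add: card_cube)
  then show ?thesis
    by (intro tendsto_eventually) (auto simp: eventually_sequentially intro!: exI[of _ "2 * b"])
next
  case False
  \<comment> \<open>\<open>K\<close> gives \<open>2 * (c * (R + h)) + 1 \<le> K * R\<close> for
    \<open>R \<ge> 1\<close>; \<open>C\<close> collects the constants of the shell bound and of
    \<open>card_box_ge\<close>, leaving a relative error of \<open>C / R\<close>.\<close>
  define K where "K = 2 * c * (1 + h) + 1"
  define C where "C = real (card J * (2 * h)) * real K ^ (k - 1) * real (2 * b) ^ k"
  have bound: "\<bar>real (card (box (R + h))) / real (card (box R)) - 1\<bar> \<le> C / real R" if R: "R \<ge> 2 * b" for R
  proof -
    have Rb: "R \<ge> b" and R1: "R \<ge> 1"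
      using R b_pos by auto
    have N: "real (card (box R)) > 0"
      using card_box_pos[OF R] by simp
    have split: "card (box (R + h)) = card (box R) + card (box (R + h) - box R)"
      using box_mono[of R "R + h"] finite_box card_mono[of "box (R + h)" "box R"]
      by (simp add: card_Diff_subset)
    have lin: "2 * (c * (R + h)) + 1 \<le> K * R"
    proof -
      have "R + h \<le> (1 + h) * R" using R1 by simp
      then have "c * (R + h) \<le> c * ((1 + h) * R)" by (rule mult_le_mono2)
      with R1 have "2 * (c * (R + h)) + 1 \<le> 2 * (c * ((1 + h) * R)) + R" by linarith
      also have "\<dots> = K * R" unfolding K_def by (simp only: algebra_simps)
      finally show ?thesis .
    qed
    have "real (card (box (R + h) - box R))
        \<le> real (card J * (2 * h) * (2 * (c * (R + h)) + 1) ^ (k - 1))"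
      using card_box_shell_le[OF Rb, of h] by (rule of_nat_mono)
    also have "\<dots> \<le> real (card J * (2 * h) * (K * R) ^ (k - 1))"
      using lin by (intro of_nat_mono mult_left_mono power_mono) auto
    also have "\<dots> = C / real R * (real R / real (2 * b)) ^ k"
      using False R1 b_pos unfolding C_def
      by (simp add: power_mult_distrib power_divide power_eq_if[of "real R" k])
    also have "\<dots> \<le> C / real R * real (card (box R))"
      using card_box_ge[OF R] unfolding C_def by (intro mult_left_mono) auto
    finally show ?thesis
      using N by (simp add: split add_divide_distrib divide_le_eq)
  qed
  have "(\<lambda>R. C / real R) \<longlonglongrightarrow> 0"
    by (rule tendsto_divide_0[OF tendsto_const]) (rule filterlim_real_at_infinity_sequentially)
  then have "(\<lambda>R. \<bar>real (card (box (R + h))) / real (card (box R)) - 1\<bar>) \<longlonglongrightarrow> 0"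
    by (rule tendsto_sandwich[rotated 2, OF tendsto_const])
       (use bound in \<open>auto simp: eventually_sequentially\<close>)
  then have "(\<lambda>R. real (card (box (R + h))) / real (card (box R)) - 1) \<longlonglongrightarrow> 0"
    by (rule tendsto_rabs_zero_cancel)
  then show ?thesis
    by (simp add: LIM_zero_iff)
qed

text \<open>Inverting the previous limit and shifting the index; truncation in \<open>R - h\<close>
  affects only finitely many terms.\<close>

lemma card_box_ratio_diff: "(\<lambda>R. real (card (box (R - h))) / real (card (box R))) \<longlonglongrightarrow> 1"
proof -
  have "(\<lambda>R. inverse (real (card (box (R + h))) / real (card (box R)))) \<longlonglongrightarrow> inverse 1"
    by (intro tendsto_inverse card_box_ratio_add) simp
  then have "(\<lambda>R. real (card (box (R + h - h))) / real (card (box (R + h)))) \<longlonglongrightarrow> 1"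
    by simp
  then show ?thesis
    using LIMSEQ_offset[of "\<lambda>R. real (card (box (R - h))) / real (card (box R))" h] by blast
qed

section \<open>Sieving by finitely many primes\<close>

text \<open>For \<open>I = {}\<close> a nonempty \<open>Q\<close> leaves no points, in agreement
  with the factor \<open>1 - 1 / q ^ 0 = 0\<close>.\<close>

definition sieve :: "nat set \<Rightarrow> nat \<Rightarrow> nat \<Rightarrow> ('i \<Rightarrow> int) set" where
  "sieve Q d R = {t \<in> box R. (\<forall>j\<in>I. int d dvd t j) \<and> (\<forall>q\<in>Q. \<exists>j\<in>I. \<not> int q dvd t j)}"

text \<open>Changing a parameter vector within its block modulo \<open>d\<close> costs only a
  constant increase of the radius, which is negligible by the ratio limits.\<close>

lemma box_perturb:
  assumes t: "t \<in> box R" and u: "u \<in> I \<rightarrow>\<^sub>E UNIV" and diff: "\<And>j. j \<in> I \<Longrightarrow> \<bar>u j - t j\<bar> \<le> int d"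
  shows "u \<in> box (R + b * d)"
proof -
  have "\<bar>x u i\<bar> \<le> int (R + b * d)" if i: "i \<in> J" for i
  proof -
    have "x u i = x t i + (\<Sum>j\<in>I. B i j * (u j - t j))"
      unfolding x_def by (simp add: algebra_simps sum_subtractf)
    moreover have "\<bar>\<Sum>j\<in>I. B i j * (u j - t j)\<bar> \<le> int (b * d)"
      using diff by (intro linear_bound i)
    moreover have "\<bar>x t i\<bar> \<le> int R"
      using t i by (simp add: box_def)
    ultimately show ?thesis by (smt (verit) of_nat_add)
  qed
  with u show ?thesis
    by (simp add: box_def)
qed

lemma finite_sieve: "finite (sieve Q d R)"
  unfolding sieve_def using finite_box by simp

lemma card_residues: "card (I \<rightarrow>\<^sub>E {0..<int d}) = d ^ k"
  using finite_I by (simp add: card_PiE)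

text \<open>Adding the \<open>d ^ k\<close> residue vectors to multiples of \<open>d\<close> is
  injective, because reduction modulo \<open>d\<close> recovers the residue vector.\<close>

lemma multiples_le_box:
  "d ^ k * card (sieve {} d R) \<le> card (box (R + b * d))"
proof -
  let ?E = "I \<rightarrow>\<^sub>E {0..<int d}"
  let ?f = "\<lambda>(t, e). restrict (\<lambda>j. t j + e j) I"
  have "inj_on ?f (sieve {} d R \<times> ?E)"
  proof (rule inj_onI, clarify)
    fix t e u f
    assume t: "t \<in> sieve {} d R" and u: "u \<in> sieve {} d R" and e: "e \<in> ?E" and f: "f \<in> ?E"
      and eq: "restrict (\<lambda>j. t j + e j) I = restrict (\<lambda>j. u j + f j) I"
    have sum_eq: "t j + e j = u j + f j" if "j \<in> I" for j
      using fun_cong[OF eq, of j] that by simp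
    have ef: "e j = f j" if j: "j \<in> I" for j
    proof -
      have "(t j + e j) mod int d = e j" "(u j + f j) mod int d = f j"
        using t u e f j by (auto simp: sieve_def PiE_iff mod_add_eq[symmetric] dvd_eq_mod_eq_0 mod_add_left_eq[symmetric])
      with sum_eq[OF j] show ?thesis by simp
    qed
    have "e = f"
      using e f ef by (rule PiE_ext)
    moreover have "t = u"
    proof (rule PiE_ext)
      show "t \<in> I \<rightarrow>\<^sub>E UNIV" "u \<in> I \<rightarrow>\<^sub>E UNIV"
        using t u by (simp_all add: sieve_def box_def)
    qed (use sum_eq ef in auto)
    ultimately show "t = u \<and> e = f" by simp
  qed
  moreover have "?f ` (sieve {} d R \<times> ?E) \<subseteq> box (R + b * d)"
  proof clarify
    fix t e assume "t \<in> sieve {} d R" "e \<in> ?E"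
    then show "restrict (\<lambda>j. t j + e j) I \<in> box (R + b * d)"
      by (intro box_perturb[of t]) (auto simp: sieve_def PiE_iff)
  qed
  ultimately have "card (sieve {} d R \<times> ?E) \<le> card (box (R + b * d))"
    using finite_box by (rule card_inj_on_le)
  then show ?thesis
    by (simp add: card_cartesian_product card_residues mult.commute)
qed

text \<open>The converse count: division with remainder determines a point by a nearby multiple of
  \<open>d\<close> and a residue vector.\<close>

lemma box_le_multiples:
  assumes "d > 0"
  shows "card (box R) \<le> d ^ k * card (sieve {} d (R + b * d))"
proof -
  let ?E = "I \<rightarrow>\<^sub>E {0..<int d}"
  let ?f = "\<lambda>t. (restrict (\<lambda>j. t j - t j mod int d) I, restrict (\<lambda>j. t j mod int d) I)"
  have "inj_on ?f (box R)"
  proof (rule inj_onI)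
    fix t u assume t: "t \<in> box R" and u: "u \<in> box R" and eq: "?f t = ?f u"
    have "t j = u j" if "j \<in> I" for j
      using fun_cong[OF conjunct1[OF eq[unfolded prod.inject]], of j]
        fun_cong[OF conjunct2[OF eq[unfolded prod.inject]], of j] that by simp
    then show "t = u"
      using t u by (intro PiE_ext[of t I "\<lambda>_. UNIV"]) (auto simp: box_def)
  qed
  moreover have "?f ` box R \<subseteq> sieve {} d (R + b * d) \<times> ?E"
  proof (rule image_subsetI)
    fix t assume t: "t \<in> box R"
    have m: "0 \<le> t j mod int d \<and> t j mod int d < int d" for j
      using assms by simp
    then have "restrict (\<lambda>j. t j - t j mod int d) I \<in> box (R + b * d)"
      by (intro box_perturb[OF t]) (auto simp: abs_le_iff less_imp_le)
    then have "restrict (\<lambda>j. t j - t j mod int d) I \<in> sieve {} d (R + b * d)"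
      by (simp add: sieve_def minus_mod_eq_mult_div)
    with m show "?f t \<in> sieve {} d (R + b * d) \<times> ?E"
      by auto
  qed
  moreover have "finite (sieve {} d (R + b * d) \<times> ?E)"
    using finite_sieve finite_I by (auto intro!: finite_PiE)
  ultimately have "card (box R) \<le> card (sieve {} d (R + b * d) \<times> ?E)"
    by (rule card_inj_on_le)
  then show ?thesis
    by (simp add: card_cartesian_product card_residues mult.commute)
qed

text \<open>The two counts enclose the proportion between box ratios at radii shifted by
  \<open>b * d\<close>, each divided by \<open>d ^ k\<close>.\<close>

lemma multiples_density:
  assumes "d > 0"
  shows "(\<lambda>R. real (card (sieve {} d R)) / real (card (box R))) \<longlonglongrightarrow> 1 / real d ^ k"
proof -
  let ?N = "\<lambda>R. real (card (box R))" and ?D = "\<lambda>R. real (card (sieve {} d R))"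
  have dk: "real d ^ k > 0"
    using assms by simp
  have lower: "?N (R - b * d) / ?N R / real d ^ k \<le> ?D R / ?N R" if "R \<ge> b * d" for R
  proof -
    have "?N (R - b * d) \<le> real (d ^ k * card (sieve {} d (R - b * d + b * d)))"
      by (intro of_nat_mono box_le_multiples assms)
    then have "?N (R - b * d) / real d ^ k \<le> ?D R"
      using that dk by (simp add: divide_le_eq mult.commute)
    then have "?N (R - b * d) / real d ^ k / ?N R \<le> ?D R / ?N R"
      by (intro divide_right_mono) auto
    then show ?thesis by (simp add: mult.commute)
  qed
  have upper: "?D R / ?N R \<le> ?N (R + b * d) / ?N R / real d ^ k" for R
  proof -
    have "real (d ^ k * card (sieve {} d R)) \<le> ?N (R + b * d)"
      by (intro of_nat_mono multiples_le_box)
    then have "?D R \<le> ?N (R + b * d) / real d ^ k"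
      using dk by (simp add: le_divide_eq mult.commute)
    then have "?D R / ?N R \<le> ?N (R + b * d) / real d ^ k / ?N R"
      by (intro divide_right_mono) auto
    then show ?thesis by (simp add: mult.commute)
  qed
  show ?thesis
  proof (rule tendsto_sandwich)
    show "\<forall>\<^sub>F R in sequentially. ?N (R - b * d) / ?N R / real d ^ k \<le> ?D R / ?N R"
      using lower by (auto simp: eventually_sequentially)
    show "\<forall>\<^sub>F R in sequentially. ?D R / ?N R \<le> ?N (R + b * d) / ?N R / real d ^ k"
      using upper by simp
    show "(\<lambda>R. ?N (R - b * d) / ?N R / real d ^ k) \<longlonglongrightarrow> 1 / real d ^ k"
      using dk by (intro tendsto_divide card_box_ratio_diff tendsto_const) simp
    show "(\<lambda>R. ?N (R + b * d) / ?N R / real d ^ k) \<longlonglongrightarrow> 1 / real d ^ k"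
      using dk by (intro tendsto_divide card_box_ratio_add tendsto_const) simp
  qed
qed

text \<open>For a prime \<open>q\<close> not dividing \<open>d\<close>, sieving by \<open>q\<close> removes from the multiples of \<open>d\<close> exactly the
  multiples of \<open>d * q\<close>; this is why \<open>d\<close> has to vary in the induction.\<close>

lemma sieve_density:
  assumes "finite Q" "\<And>q. q \<in> Q \<Longrightarrow> prime q" "d > 0" "\<And>q. q \<in> Q \<Longrightarrow> coprime d q"
  shows "(\<lambda>R. real (card (sieve Q d R)) / real (card (box R)))
           \<longlonglongrightarrow> (\<Prod>q\<in>Q. 1 - 1 / real q ^ k) / real d ^ k"
  using assms
proof (induction Q arbitrary: d rule: finite_induct)
  case empty
  then show ?case using multiples_density by simp
next
  case (insert q Q)
  have q: "prime q" and cop: "coprime d q"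
    using insert.prems by auto
  have q0: "q > 0" using q prime_gt_0_nat by blast
  have mult: "int (d * q) dvd z \<longleftrightarrow> int d dvd z \<and> int q dvd z" for z
    using cop by (auto intro: divides_mult dvd_mult_left dvd_mult_right)
  have sub: "sieve Q (d * q) R \<subseteq> sieve Q d R" for R
    unfolding sieve_def mult by blast
  have "sieve (insert q Q) d R = sieve Q d R - sieve Q (d * q) R" for R
    unfolding sieve_def mult by blast
  then have card: "real (card (sieve (insert q Q) d R))
      = real (card (sieve Q d R)) - real (card (sieve Q (d * q) R))" for R
    using sub[of R] finite_sieve card_mono[OF finite_sieve sub[of R]] by (simp add: card_Diff_subset of_nat_diff)
  have "(\<lambda>R. real (card (sieve Q d R)) / real (card (box R)))
      \<longlonglongrightarrow> (\<Prod>q\<in>Q. 1 - 1 / real q ^ k) / real d ^ k"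
    using insert.prems by (intro insert.IH) auto
  moreover have "(\<lambda>R. real (card (sieve Q (d * q) R)) / real (card (box R)))
      \<longlonglongrightarrow> (\<Prod>q\<in>Q. 1 - 1 / real q ^ k) / real (d * q) ^ k"
  proof (intro insert.IH)
    fix r assume r: "r \<in> Q"
    then have "coprime q r"
      using q insert.prems insert.hyps by (intro primes_coprime) auto
    with r show "coprime (d * q) r"
      using insert.prems by auto
  qed (use insert.prems q0 in auto)
  ultimately have "(\<lambda>R. real (card (sieve (insert q Q) d R)) / real (card (box R)))
      \<longlonglongrightarrow> (\<Prod>q\<in>Q. 1 - 1 / real q ^ k) / real d ^ k
        - (\<Prod>q\<in>Q. 1 - 1 / real q ^ k) / real (d * q) ^ k"
    unfolding card diff_divide_distrib by (rule tendsto_diff)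
  also have "(\<Prod>q\<in>Q. 1 - 1 / real q ^ k) / real d ^ k - (\<Prod>q\<in>Q. 1 - 1 / real q ^ k) / real (d * q) ^ k
      = (\<Prod>q\<in>insert q Q. 1 - 1 / real q ^ k) / real d ^ k"
    using insert.hyps q0 insert.prems by (simp add: field_simps power_mult_distrib)
  finally show ?case .
qed

section \<open>Density of visible parameter vectors\<close>

text \<open>\<open>g\<close> stands for the gcd of the fixed Smith coordinates, while
  \<open>t\<close> holds the free ones.\<close>

definition vis :: "int \<Rightarrow> nat \<Rightarrow> ('i \<Rightarrow> int) set" where
  "vis g R = {t \<in> box R. gcd g (Gcd (t ` I)) = 1}"

lemma vis_iff:
  "t \<in> vis g R \<longleftrightarrow>
     t \<in> box R \<and> (\<forall>q. prime q \<and> int q dvd g \<longrightarrow> (\<exists>j\<in>I. \<not> int q dvd t j))"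
  unfolding vis_def gcd_int_eq_1_iff by (auto simp: dvd_Gcd_iff)

text \<open>A nonzero \<open>g\<close> has finitely many prime divisors, so a single finite sieve
  with \<open>d = 1\<close> is exact.\<close>

lemma vis_density_nonzero:
  assumes "g \<noteq> 0"
  shows "(\<lambda>R. real (card (vis g R)) / real (card (box R))) \<longlonglongrightarrow> euler_product g k"
proof -
  let ?Q = "{p. prime p \<and> int p dvd g}"
  have "finite ?Q"
  proof (rule finite_subset)
    show "?Q \<subseteq> {..nat \<bar>g\<bar>}"
    proof
      fix p assume "p \<in> ?Q"
      then have "\<bar>int p\<bar> \<le> \<bar>g\<bar>"
        using dvd_imp_le_int[OF assms] by blast
      then show "p \<in> {..nat \<bar>g\<bar>}" by simp
    qed
  qed simp
  then have "(\<lambda>R. real (card (sieve ?Q 1 R)) / real (card (box R)))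
      \<longlonglongrightarrow> (\<Prod>q\<in>?Q. 1 - 1 / real q ^ k) / real 1 ^ k"
    by (rule sieve_density) auto
  moreover have "vis g R = sieve ?Q 1 R" for R
    by (auto simp: vis_iff sieve_def)
  ultimately show ?thesis
    by (simp only: euler_product_finite[OF assms] of_nat_1 power_one div_by_1)
qed

text \<open>Division by \<open>d\<close> embeds these points into a smaller cube. Unlike
  \<open>multiples_density\<close>, the bound is uniform in \<open>d\<close> and can be summed over
  a range growing with \<open>R\<close>.\<close>

lemma card_multiples_cube_le:
  assumes "d > 0"
  shows "card {t \<in> cube S. \<forall>j\<in>I. int d dvd t j} \<le> (2 * (S div d) + 1) ^ k"
proof -
  let ?f = "\<lambda>t. restrict (\<lambda>j. t j div int d) I"
  have "inj_on ?f {t \<in> cube S. \<forall>j\<in>I. int d dvd t j}"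
  proof (rule inj_onI)
    fix t u
    assume t: "t \<in> {t \<in> cube S. \<forall>j\<in>I. int d dvd t j}" and u: "u \<in> {t \<in> cube S. \<forall>j\<in>I. int d dvd t j}"
      and eq: "?f t = ?f u"
    have "t j = u j" if j: "j \<in> I" for j
    proof -
      have "t j div int d = u j div int d"
        using fun_cong[OF eq, of j] j by simp
      with t u j show ?thesis by (simp add: dvd_div_eq_iff)
    qed
    then show "t = u"
      using t u unfolding cube_def by (blast intro: PiE_ext)
  qed
  moreover have "?f ` {t \<in> cube S. \<forall>j\<in>I. int d dvd t j} \<subseteq> cube (S div d)"
  proof (rule image_subsetI)
    fix t assume t: "t \<in> {t \<in> cube S. \<forall>j\<in>I. int d dvd t j}"
    have "t j div int d \<in> {- int (S div d)..int (S div d)}" if j: "j \<in> I" for j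
    proof -
      obtain y where y: "t j = int d * y"
        using t j by blast
      have "\<bar>t j\<bar> \<le> int S"
        using t j by (auto simp: cube_def PiE_iff abs_le_iff)
      then have "int d * \<bar>y\<bar> \<le> int S"
        using y by (simp add: abs_mult)
      then have "\<bar>y\<bar> \<le> int S div int d"
        using assms by (simp add: zdiv_mono1[of "int d * \<bar>y\<bar>" "int S" "int d", simplified])
      with y assms show ?thesis by (auto simp: zdiv_int)
    qed
    then show "?f t \<in> cube (S div d)"
      unfolding cube_def restrict_PiE_iff by blast
  qed
  ultimately have "card {t \<in> cube S. \<forall>j\<in>I. int d dvd t j} \<le> card (cube (S div d))"
    using finite_cube by (rule card_inj_on_le)
  then show ?thesis
    by (simp add: card_cube)
qed

text \<open>A point surviving the sieve by the primes up to \<open>P\<close> is nonzero because \<open>2 \<le> P\<close>, so any prime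
  dividing all its coordinates lies in the finite range \<open>{P<..c * R}\<close>.\<close>

lemma vis_zero_ge:
  assumes k: "k \<ge> 2" and P: "P \<ge> 2" and R: "R \<ge> 2 * b"
  shows "real (card (sieve {p. prime p \<and> p \<le> P} 1 R)) / real (card (box R)) - real (6 * b * c) ^ k / real P
           \<le> real (card (vis 0 R)) / real (card (box R))"
proof -
  define S where "S = c * R"
  let ?Q = "{p. prime p \<and> p \<le> P}"
  let ?M = "\<lambda>d. {t \<in> cube S. \<forall>j\<in>I. int d dvd t j}"
  have box_S: "box R \<subseteq> cube S"
    unfolding S_def by (rule box_subset_cube)
  have N: "real (card (box R)) > 0"
    using card_box_pos[OF R] by simp
  have "sieve ?Q 1 R \<subseteq> vis 0 R \<union> (\<Union>d\<in>{P<..S}. ?M d)"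
  proof
    fix t assume t: "t \<in> sieve ?Q 1 R"
    show "t \<in> vis 0 R \<union> (\<Union>d\<in>{P<..S}. ?M d)"
    proof (cases "t \<in> vis 0 R")
      case False
      with t obtain q where q: "prime q" "\<forall>j\<in>I. int q dvd t j"
        by (auto simp: vis_iff sieve_def)
      have "q \<notin> ?Q"
        using t q unfolding sieve_def by blast
      then have "q > P"
        using q by simp
      have "2 \<in> ?Q"
        using P by simp
      then obtain j where j: "j \<in> I" "\<not> int 2 dvd t j"
        using t unfolding sieve_def by blast
      have t_cube: "t \<in> cube S"
        using t box_S unfolding sieve_def by blast
      have "t j \<noteq> 0"
        using j(2) by auto
      moreover have "\<bar>t j\<bar> \<le> int S"
        using t_cube j(1) unfolding cube_def by (auto simp: PiE_iff abs_le_iff)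
      ultimately have "int q \<le> int S"
        using q(2) j(1) dvd_imp_le_int[of "t j" "int q"] by (simp del: of_nat_mult)
      then have "q \<le> S"
        by (simp only: of_nat_le_iff)
      then have "q \<in> {P<..S}"
        using \<open>q > P\<close> by simp
      moreover have "t \<in> ?M q"
        using t_cube q(2) by blast
      ultimately show ?thesis by blast
    qed simp
  qed
  then have "card (sieve ?Q 1 R) \<le> card (vis 0 R \<union> (\<Union>d\<in>{P<..S}. ?M d))"
    using finite_box finite_cube by (intro card_mono) (auto simp: vis_def)
  also have "\<dots> \<le> card (vis 0 R) + card (\<Union>d\<in>{P<..S}. ?M d)"
    by (rule card_Un_le)
  also have "\<dots> \<le> card (vis 0 R) + (\<Sum>d\<in>{P<..S}. card (?M d))"
    by (intro add_left_mono card_UN_le) simp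
  finally have "real (card (sieve ?Q 1 R)) \<le> real (card (vis 0 R) + (\<Sum>d\<in>{P<..S}. card (?M d)))"
    by (rule of_nat_mono)
  also have "\<dots> = real (card (vis 0 R)) + (\<Sum>d\<in>{P<..S}. real (card (?M d)))"
    by (simp only: of_nat_add of_nat_sum)
  \<comment> \<open>From \<open>d \<le> S\<close> follows
    \<open>2 * (S div d) + 1 \<le> 3 * S / d\<close>; then \<open>k \<ge> 2\<close> permits the
    summable weight \<open>1 / d ^ 2\<close>.\<close>
  also have "(\<Sum>d\<in>{P<..S}. real (card (?M d))) \<le> (\<Sum>d\<in>{P<..S}. real (3 * S) ^ k * (1 / real d ^ 2))"
  proof (rule sum_mono)
    fix d assume d: "d \<in> {P<..S}"
    then have d1: "d \<ge> 1" and dS: "d \<le> S" by auto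
    have "real (card (?M d)) \<le> real (2 * (S div d) + 1) ^ k"
      unfolding of_nat_power[symmetric] using d1 by (intro of_nat_mono card_multiples_cube_le) simp
    also have "\<dots> \<le> (real (3 * S) / real d) ^ k"
    proof (rule power_mono)
      have "real (S div d) \<le> real S / real d"
        by (rule of_nat_div_le_of_nat)
      moreover have "1 \<le> real S / real d"
        using d1 dS by (simp add: le_divide_eq)
      ultimately show "real (2 * (S div d) + 1) \<le> real (3 * S) / real d" by simp
    qed simp
    also have "\<dots> = real (3 * S) ^ k * (1 / real d ^ k)"
      by (simp add: power_divide)
    also have "\<dots> \<le> real (3 * S) ^ k * (1 / real d ^ 2)"
      using d1 k by (intro mult_left_mono divide_left_mono power_increasing) auto
    finally show "real (card (?M d)) \<le> real (3 * S) ^ k * (1 / real d ^ 2)" .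
  qed
  also have "\<dots> = real (3 * S) ^ k * (\<Sum>d\<in>{P<..S}. 1 / real d ^ 2)"
    by (simp only: sum_distrib_left)
  also have "\<dots> \<le> real (3 * S) ^ k * (1 / real P)"
    using P by (intro mult_left_mono sum_inverse_squares_tail) auto
  \<comment> \<open>Writing \<open>3 * c * R\<close> as \<open>6 * b * c * (R / (2 * b))\<close>
    isolates the lower bound of \<open>card_box_ge\<close>.\<close>
  also have "\<dots> = real (6 * b * c) ^ k / real P * (real R / real (2 * b)) ^ k"
  proof -
    have "real (3 * S) = real (6 * b * c) * (real R / real (2 * b))"
      using b_pos by (simp add: S_def)
    then have "real (3 * S) ^ k = real (6 * b * c) ^ k * (real R / real (2 * b)) ^ k"
      by (simp only: power_mult_distrib)
    then show ?thesis by simp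
  qed
  also have "\<dots> \<le> real (6 * b * c) ^ k / real P * real (card (box R))"
    using card_box_ge[OF R] by (intro mult_left_mono) auto
  finally have "real (card (sieve ?Q 1 R)) / real (card (box R))
      \<le> (real (card (vis 0 R)) + real (6 * b * c) ^ k / real P * real (card (box R))) / real (card (box R))"
    by (intro divide_right_mono) auto
  also have "\<dots> = real (card (vis 0 R)) / real (card (box R)) + real (6 * b * c) ^ k / real P"
    using N by (simp add: add_divide_distrib)
  finally show ?thesis by linarith
qed

text \<open>\<open>P\<close> is fixed first, making both the truncation error of the Euler product
  and the tail term of \<open>vis_zero_ge\<close> less than \<open>e / 3\<close>; for this
  \<open>P\<close> the finite sieve converges in \<open>R\<close>. The upper estimate holds since
  visible points survive every sieve.\<close>

lemma vis_density_zero: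
  assumes k: "k \<ge> 2"
  shows "(\<lambda>R. real (card (vis 0 R)) / real (card (box R))) \<longlonglongrightarrow> euler_product 0 k"
proof (rule LIMSEQ_I)
  fix e :: real assume e: "e > 0"
  let ?Q = "\<lambda>P. {p. prime p \<and> p \<le> P}"
  let ?L = "\<lambda>P. \<Prod>p\<in>?Q P. 1 - 1 / real p ^ k"
  let ?K = "real (6 * b * c) ^ k"
  have "?L \<longlonglongrightarrow> euler_product 0 k"
    using euler_product_LIMSEQ[where g = 0 and k = k] by simp
  from LIMSEQ_D[OF this, of "e / 3"] e
  obtain P1 where P1: "\<And>P. P \<ge> P1 \<Longrightarrow> \<bar>?L P - euler_product 0 k\<bar> < e / 3"
    by auto
  have "(\<lambda>P. ?K / real P) \<longlonglongrightarrow> 0"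
    by (rule tendsto_divide_0[OF tendsto_const]) (rule filterlim_real_at_infinity_sequentially)
  from LIMSEQ_D[OF this, of "e / 3"] e
  obtain P2 where P2: "\<And>P. P \<ge> P2 \<Longrightarrow> ?K / real P < e / 3"
    by (auto simp: abs_less_iff)
  define P where "P = max 2 (max P1 P2)"
  have P: "P \<ge> 2" "P \<ge> P1" "P \<ge> P2"
    by (auto simp: P_def)
  have "finite (?Q P)"
    by (rule finite_subset[of _ "{..P}"]) auto
  then have "(\<lambda>R. real (card (sieve (?Q P) 1 R)) / real (card (box R))) \<longlonglongrightarrow> ?L P / real 1 ^ k"
    by (rule sieve_density) auto
  from LIMSEQ_D[OF this[unfolded of_nat_1 power_one div_by_1], of "e / 3"] e
  obtain R0 where R0: "\<And>R. R \<ge> R0 \<Longrightarrow>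
      \<bar>real (card (sieve (?Q P) 1 R)) / real (card (box R)) - ?L P\<bar> < e / 3"
    by auto
  show "\<exists>R0. \<forall>R\<ge>R0. norm (real (card (vis 0 R)) / real (card (box R)) - euler_product 0 k) < e"
  proof (intro exI[of _ "max R0 (2 * b)"] allI impI)
    fix R assume "R \<ge> max R0 (2 * b)"
    then have R: "R \<ge> R0" "R \<ge> 2 * b" by auto
    have "card (vis 0 R) \<le> card (sieve (?Q P) 1 R)"
      by (rule card_mono[OF finite_sieve]) (auto simp: vis_iff sieve_def)
    then have "real (card (vis 0 R)) / real (card (box R))
        \<le> real (card (sieve (?Q P) 1 R)) / real (card (box R))"
      by (intro divide_right_mono) auto
    then show "norm (real (card (vis 0 R)) / real (card (box R)) - euler_product 0 k) < e"
      using vis_zero_ge[OF k P(1) R(2)] P1[OF P(2)] P2[OF P(3)] R0[OF R(1)]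
      unfolding real_norm_def by linarith
  qed
qed

text \<open>For \<open>k = 0\<close> the gcd is 0, so nothing is visible. For \<open>k = 1\<close>
  the only coordinate must be 1 or -1, so the 3 points of \<open>cube 1\<close> suffice as a bound
  while the box grows linearly.\<close>

lemma vis_density_zero_dim_le_1:
  assumes k: "k \<le> 1"
  shows "(\<lambda>R. real (card (vis 0 R)) / real (card (box R))) \<longlonglongrightarrow> euler_product 0 k"
  unfolding euler_product_0_eq_0[OF k]
proof (cases "k = 0")
  case True
  then have "I = {}"
    using finite_I by simp
  then have "vis 0 R = {}" for R
    unfolding vis_def by simp
  then show "(\<lambda>R. real (card (vis 0 R)) / real (card (box R))) \<longlonglongrightarrow> 0"
    by simp
next
  case False
  with k have k1: "k = 1" by simp
  then obtain j where I: "I = {j}"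
    by (auto simp: card_1_singleton_iff)
  have "vis 0 R \<subseteq> cube 1" for R
  proof
    fix t assume t: "t \<in> vis 0 R"
    then have "\<bar>t j\<bar> = 1"
      unfolding vis_def by (simp add: I)
    with t show "t \<in> cube 1"
      unfolding vis_def box_def cube_def by (auto simp: PiE_iff I abs_if split: if_splits)
  qed
  then have card_vis: "card (vis 0 R) \<le> 3" for R
    using card_mono[OF finite_cube, of "vis 0 R" 1] k1 by (simp add: card_cube)
  have bound: "real (card (vis 0 R)) / real (card (box R)) \<le> 6 * real b / real R" if R: "R \<ge> 2 * b" for R
  proof -
    have "real R / real (2 * b) \<le> real (card (box R))"
      using card_box_ge[OF R] k1 by simp
    moreover have "real R > 0"
      using R b_pos by simp
    ultimately have "real (card (vis 0 R)) / real (card (box R)) \<le> 3 / (real R / real (2 * b))"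
      using card_vis[of R] b_pos by (intro frac_le) auto
    then show ?thesis by simp
  qed
  have "(\<lambda>R. 6 * real b / real R) \<longlonglongrightarrow> 0"
    by (rule tendsto_divide_0[OF tendsto_const]) (rule filterlim_real_at_infinity_sequentially)
  then show "(\<lambda>R. real (card (vis 0 R)) / real (card (box R))) \<longlonglongrightarrow> 0"
    by (rule tendsto_sandwich[rotated 2, OF tendsto_const])
       (use bound in \<open>auto simp: eventually_sequentially\<close>)
qed

lemma vis_density:
  "(\<lambda>R. real (card (vis g R)) / real (card (box R))) \<longlonglongrightarrow> euler_product g k"
  using vis_density_nonzero[of g] vis_density_zero vis_density_zero_dim_le_1
  by (cases "g = 0"; cases "k \<ge> 2") simp_all

end

section \<open>Smith coordinates\<close>

text \<open>The columns of \<open>X * Y\<close> lie in the span of the \<open>r\<close> columns of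
  \<open>X\<close>.\<close>

lemma (in vec_space) rank_mult_le:
  assumes X: "X \<in> carrier_mat n r" and Y: "Y \<in> carrier_mat r nc"
  shows "rank (X * Y) \<le> r"
proof -
  let ?S = "set (cols X)" and ?T = "set (cols (X * Y))"
  have S: "?S \<subseteq> carrier_vec n"
    using X cols_dim by blast
  have T: "?T \<subseteq> span ?S"
  proof
    fix v assume "v \<in> ?T"
    then obtain j where j: "j < nc" "v = col (X * Y) j"
      using Y by (auto simp: cols_def)
    then have "v = X *\<^sub>v col Y j"
      using X Y by (auto intro!: col_mult2)
    moreover have "col Y j \<in> carrier_vec r"
      using Y by auto
    ultimately show "v \<in> span ?S"
      using X by (auto simp: col_space_eq[OF X] col_space_def[symmetric])
  qed
  have sub: "submodule class_ring (span ?S) V"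
    using S by (simp add: span_is_submodule)
  have vs: "vectorspace class_ring (span_vs ?S)"
    using S by (intro subspace_is_vs span_is_subspace)
  \<comment> \<open>Dimensions are compared inside \<open>span ?S\<close> viewed as a vector space;
    spans taken there and in the ambient space agree.\<close>
  have "VectorSpace.subspace class_ring (span ?T) (span_vs ?S)"
    using vectorspace.span_is_subspace[OF vs, of ?T] T span_li_not_depend(1)[OF T sub] by simp
  moreover have "vectorspace.fin_dim class_ring (span_vs ?S)"
    "vectorspace.fin_dim class_ring (span_vs ?S\<lparr>carrier := span ?T\<rparr>)"
    using fin_dim_span_cols[OF X] fin_dim_span_cols[OF mult_carrier_mat[OF X Y]] by auto
  ultimately have "rank (X * Y) \<le> vectorspace.dim class_ring (span_vs ?S)"
    unfolding rank_def using vectorspace.subspace_dim[OF vs] by simp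
  also have "\<dots> \<le> card ?S"
  proof (rule vectorspace.gen_ge_dim[OF vs])
    show "?S \<subseteq> carrier (span_vs ?S)"
      using S in_own_span by simp
    then show "LinearCombinations.module.gen_set class_ring (span_vs ?S) ?S"
      using span_li_not_depend(1)[OF _ sub, of ?S] by simp
  qed simp
  also have "\<dots> \<le> r"
    using card_length[of "cols X"] X by simp
  finally show ?thesis .
qed

lemma int_rank_mult_le:
  assumes "X \<in> carrier_mat s r" "Y \<in> carrier_mat r n"
  shows "int_rank (X * Y) \<le> r"
  using vec_space.rank_mult_le[of "map_mat rat_of_int X" s r "map_mat rat_of_int Y" n] assms
  by (simp add: int_rank_def of_int_hom.mat_hom_mult[OF assms])

text \<open>Factor \<open>A\<close> through an identity matrix on either side.\<close>

lemma int_rank_le: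
  assumes "A \<in> carrier_mat s n"
  shows "int_rank A \<le> s" "int_rank A \<le> n"
proof -
  show "int_rank A \<le> s"
    using int_rank_mult_le[of "1\<^sub>m s" s s A n] assms by simp
  show "int_rank A \<le> n"
    using int_rank_mult_le[of A s n "1\<^sub>m n" n] assms by simp
qed

lemma GL_inverse:
  assumes "U \<in> GL s"
  obtains U' where "U' \<in> carrier_mat s s" "U' * U = 1\<^sub>m s"
proof -
  from assms have U: "U \<in> carrier_mat s s" and "invertible_mat U"
    by (auto simp: GL_def)
  then obtain U' where U': "U * U' = 1\<^sub>m s" "U' * U = 1\<^sub>m (dim_row U')"
    by (auto simp: invertible_mat_def inverts_mat_def)
  have "dim_col U' = s"
    using arg_cong[OF U'(1), of dim_col] by simp
  moreover have "dim_row U' = s"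
    using arg_cong[OF U'(2), of dim_col] U by simp
  ultimately show thesis
    using U' by (intro that[of U']) auto
qed

text \<open>If \<open>D $$ (i, i) = 0\<close>, then by the divisibility chain only the first \<open>i\<close> rows of \<open>D\<close> are nonzero, so
  \<open>A = U\<^sup>-\<^sup>1 D V\<^sup>-\<^sup>1\<close> factors through dimension \<open>i\<close>.\<close>

lemma smith_diag_nonzero:
  assumes A: "A \<in> carrier_mat s n" and U: "U \<in> GL s"
    and V: "V \<in> carrier_mat n n" and W: "W \<in> carrier_mat n n" "V * W = 1\<^sub>m n"
    and D: "U * A * V = D" and snf: "is_smith_normal_form A D" and i: "i < int_rank A"
  shows "D $$ (i, i) \<noteq> 0"
proof
  assume zero: "D $$ (i, i) = 0"
  obtain U' where U': "U' \<in> carrier_mat s s" "U' * U = 1\<^sub>m s"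
    by (rule GL_inverse[OF U])
  have Uc: "U \<in> carrier_mat s s"
    using U by (simp add: GL_def)
  have Dc: "D \<in> carrier_mat s n"
    using D Uc A V by auto
  have zeros: "l < min s n \<Longrightarrow> D $$ (l, l) = 0" if "i \<le> l" for l
    using that
  proof (induction l rule: dec_induct)
    case base
    show ?case by (rule zero)
  next
    case (step l)
    then have "D $$ (l, l) dvd D $$ (Suc l, Suc l)"
      using snf A by (auto simp: is_smith_normal_form_def)
    with step show ?case by simp
  qed
  have row_zero: "D $$ (l, j) = 0" if "i \<le> l" "l < s" "j < n" for l j
    using snf Dc zeros[of l] that
    by (cases "l = j") (auto simp: is_smith_normal_form_def diagonal_mat_def)
  \<comment> \<open>The first \<open>i\<close> columns of \<open>U'\<close> and the first
    \<open>i\<close> rows of \<open>D * W\<close>; the later rows of \<open>D * W\<close> vanish, so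
    \<open>X * Y\<close> is still \<open>U' * (D * W) = A\<close>.\<close>
  define X where "X = mat s i (\<lambda>(a, l). U' $$ (a, l))"
  define Y where "Y = mat i n (\<lambda>(l, j). (D * W) $$ (l, j))"
  have i_le: "i \<le> s"
    using i int_rank_le(1)[OF A] by simp
  have DW: "D * W = U * A"
  proof -
    have "D * W = U * A * (V * W)"
      unfolding D[symmetric] using Uc A V W by (intro assoc_mult_mat) auto
    then show ?thesis
      using Uc A W by simp
  qed
  have "A = U' * U * A"
    using U' A by simp
  also have "\<dots> = U' * (D * W)"
    unfolding DW using U' Uc A by (intro assoc_mult_mat) auto
  also have "\<dots> = X * Y"
  proof (rule eq_matI)
    fix a j assume "a < dim_row (X * Y)" "j < dim_col (X * Y)"
    then have a: "a < s" and j: "j < n"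
      by (auto simp: X_def Y_def)
    have "(D * W) $$ (l, j) = 0" if "i \<le> l" "l < s" for l
      using Dc W that j row_zero[OF that] by (auto simp: scalar_prod_def)
    then have "(\<Sum>l = 0..<s. U' $$ (a, l) * (D * W) $$ (l, j)) = (\<Sum>l = 0..<i. U' $$ (a, l) * (D * W) $$ (l, j))"
      using i_le by (intro sum.mono_neutral_right) auto
    then show "(U' * (D * W)) $$ (a, j) = (X * Y) $$ (a, j)"
      using a j U' Dc W i_le by (simp add: X_def Y_def scalar_prod_def del: index_mult_mat(1)) (simp add: scalar_prod_def)
  qed (use U' W in \<open>auto simp: X_def Y_def\<close>)
  finally have "int_rank A \<le> i"
    using int_rank_mult_le[of X s i Y n] by (simp add: X_def Y_def)
  with i show False by simp
qed

lemma hyperplane_intersection_iff: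
  assumes "A \<in> carrier_mat s n" "q \<in> carrier_vec n" "z \<in> carrier_vec n"
  shows "real_vec z \<in> hyperplane_intersection n A q \<longleftrightarrow> A *\<^sub>v z = A *\<^sub>v q"
  using assms
  by (auto simp: hyperplane_intersection_def of_int_hom.mult_mat_vec_hom[symmetric] dest: of_int_hom.vec_hom_inj)

lemma mult_mat_vec_inverse:
  fixes M M' :: "int mat"
  assumes "M \<in> carrier_mat n n" "M' \<in> carrier_mat n n" "M * M' = 1\<^sub>m n" "z \<in> carrier_vec n"
  shows "M *\<^sub>v (M' *\<^sub>v z) = z"
  using assms by (simp add: assoc_mult_mat_vec[symmetric])

text \<open>Invertibility of \<open>U\<close> turns the system into
  \<open>D (W z) = D (W q)\<close>. Row \<open>i\<close> of \<open>D\<close> scales coordinate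
  \<open>i\<close> by a nonzero factor below the rank, which cancels, and gives 0 beyond it.\<close>

lemma smith_coordinates_iff:
  assumes A: "A \<in> carrier_mat s n" and U: "U \<in> GL s"
    and V: "V \<in> carrier_mat n n" and W: "W \<in> carrier_mat n n" "V * W = 1\<^sub>m n"
    and D: "U * A * V = D" and snf: "is_smith_normal_form A D"
    and z: "z \<in> carrier_vec n" and q: "q \<in> carrier_vec n"
  shows "A *\<^sub>v z = A *\<^sub>v q \<longleftrightarrow> (\<forall>i < int_rank A. (W *\<^sub>v z) $ i = (W *\<^sub>v q) $ i)"
proof -
  obtain U' where U': "U' \<in> carrier_mat s s" "U' * U = 1\<^sub>m s"
    by (rule GL_inverse[OF U])
  have Uc: "U \<in> carrier_mat s s"
    using U by (simp add: GL_def)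
  have Dc: "D \<in> carrier_mat s n"
    using D Uc A V by auto
  have UA: "D *\<^sub>v (W *\<^sub>v y) = U *\<^sub>v (A *\<^sub>v y)" if y: "y \<in> carrier_vec n" for y
  proof -
    have "D *\<^sub>v (W *\<^sub>v y) = U * A *\<^sub>v (V *\<^sub>v (W *\<^sub>v y))"
      unfolding D[symmetric] using Uc A V W y by (intro assoc_mult_mat_vec) auto
    also have "\<dots> = U *\<^sub>v (A *\<^sub>v y)"
      unfolding mult_mat_vec_inverse[OF V W y] using Uc A y by (intro assoc_mult_mat_vec) auto
    finally show ?thesis .
  qed
  have U_cancel: "U' *\<^sub>v (U *\<^sub>v (A *\<^sub>v y)) = A *\<^sub>v y" if "y \<in> carrier_vec n" for y
    using mult_mat_vec_inverse[OF U'(1) Uc U'(2)] A that by simp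
  have entry: "(D *\<^sub>v y) $ i = (if i < int_rank A then D $$ (i, i) * y $ i else 0)"
    if y: "y \<in> carrier_vec n" and i: "i < s" for y i
  proof -
    have "(D *\<^sub>v y) $ i = (\<Sum>j = 0..<n. D $$ (i, j) * y $ j)"
      using Dc y i by (simp add: scalar_prod_def)
    also have "\<dots> = (\<Sum>j = 0..<n. if j = i then D $$ (i, i) * y $ i else 0)"
      using snf Dc i by (intro sum.cong) (auto simp: is_smith_normal_form_def diagonal_mat_def)
    also have "\<dots> = (if i < n then D $$ (i, i) * y $ i else 0)"
      by simp
    also have "\<dots> = (if i < int_rank A then D $$ (i, i) * y $ i else 0)"
      using snf A i int_rank_le(2)[OF A] by (auto simp: is_smith_normal_form_def)
    finally show ?thesis .
  qed
  have "A *\<^sub>v z = A *\<^sub>v q \<longleftrightarrow> D *\<^sub>v (W *\<^sub>v z) = D *\<^sub>v (W *\<^sub>v q)"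
    using UA[OF z] UA[OF q] U_cancel[OF z] U_cancel[OF q] by metis
  also have "\<dots> \<longleftrightarrow> (\<forall>i<s. (D *\<^sub>v (W *\<^sub>v z)) $ i = (D *\<^sub>v (W *\<^sub>v q)) $ i)"
    using Dc by (auto simp: vec_eq_iff)
  also have "\<dots> \<longleftrightarrow> (\<forall>i < int_rank A. (W *\<^sub>v z) $ i = (W *\<^sub>v q) $ i)"
  proof -
    have Wy: "W *\<^sub>v y \<in> carrier_vec n" if "y \<in> carrier_vec n" for y
      using W that by auto
    show ?thesis
      using smith_diag_nonzero[OF A U V W D snf] int_rank_le(1)[OF A] entry[OF Wy[OF z]] entry[OF Wy[OF q]]
      by (auto simp: less_le_trans)
  qed
  finally show ?thesis .
qed

section \<open>Visibility under unimodular maps\<close>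

lemma Gcd_int_Un: "Gcd (S \<union> T) = gcd (Gcd S) (Gcd T)" for S T :: "int set"
proof (rule zdvd_antisym_nonneg)
  show "gcd (Gcd S) (Gcd T) dvd Gcd (S \<union> T)"
    by (rule Gcd_greatest) (auto intro: dvd_trans[OF gcd_dvd1] dvd_trans[OF gcd_dvd2])
qed (auto intro: Gcd_greatest)

text \<open>Each entry of the image is an integer combination of the entries of \<open>z\<close>.
  Used for \<open>V\<close> and for its inverse, this shows that unimodular maps preserve the
  gcd.\<close>

lemma Gcd_dvd_Gcd_mult_mat_vec:
  fixes M :: "int mat"
  assumes "M \<in> carrier_mat k n" "z \<in> carrier_vec n"
  shows "Gcd {z $ i | i. i < n} dvd Gcd {(M *\<^sub>v z) $ i | i. i < k}"
proof (rule Gcd_greatest)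
  fix y assume "y \<in> {(M *\<^sub>v z) $ i | i. i < k}"
  then obtain i where i: "i < k" "y = (M *\<^sub>v z) $ i" by blast
  have "y = (\<Sum>j = 0..<n. M $$ (i, j) * z $ j)"
    using assms i by (simp add: scalar_prod_def)
  moreover have "Gcd {z $ i | i. i < n} dvd z $ j" if "j < n" for j
    using that by (intro Gcd_dvd) blast
  ultimately show "Gcd {z $ i | i. i < n} dvd y"
    by (auto intro!: dvd_sum dvd_mult)
qed

lemma visible_unimodular_iff:
  assumes "V \<in> carrier_mat n n" "W \<in> carrier_mat n n" "W * V = 1\<^sub>m n" "y \<in> carrier_vec n"
  shows "visible (V *\<^sub>v y) \<longleftrightarrow> Gcd {y $ i | i. i < n} = 1"
proof -
  have "Gcd {(V *\<^sub>v y) $ i | i. i < n} dvd Gcd {(W *\<^sub>v (V *\<^sub>v y)) $ i | i. i < n}"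
    using assms by (intro Gcd_dvd_Gcd_mult_mat_vec) auto
  moreover have "Gcd {y $ i | i. i < n} dvd Gcd {(V *\<^sub>v y) $ i | i. i < n}"
    using assms by (intro Gcd_dvd_Gcd_mult_mat_vec) auto
  ultimately have "Gcd {(V *\<^sub>v y) $ i | i. i < n} = Gcd {y $ i | i. i < n}"
    using mult_mat_vec_inverse[of W n V y] assms by (intro zdvd_antisym_nonneg) auto
  then show ?thesis
    using assms by (simp add: visible_def)
qed

section \<open>Visible density on the hyperplane intersection\<close>

theorem theorem3p3:
  fixes s n m :: nat
    and A U V W D :: "int mat"
    and p p' :: "int vec"
  assumes A: "A \<in> carrier_mat s n"
    and gcd_A: "Gcd (elements_mat A) = 1"
    and p: "p \<in> carrier_vec n"
    and U: "U \<in> GL s"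
    and V: "V \<in> GL n"
    and D: "U * A * V = D"
    and snf: "is_smith_normal_form A D"
    and m: "m = int_rank A"
    and W: "W \<in> carrier_mat n n" "inverts_mat V W" "inverts_mat W V"
    and p': "p' = W *\<^sub>v p"
  shows "has_visible_density n (hyperplane_intersection n A p)
           (euler_product (Gcd {p' $ i | i. i < m}) (n - m))"
proof -
  have Vc: "V \<in> carrier_mat n n"
    using V by (simp add: GL_def)
  have VW: "V * W = 1\<^sub>m n" and WV: "W * V = 1\<^sub>m n"
    using W Vc by (auto simp: inverts_mat_def)
  have mn: "m \<le> n"
    using int_rank_le(2)[OF A] m by simp
  \<comment> \<open>\<open>I\<close> indexes the free Smith coordinates and \<open>a\<close> is the
    contribution of the fixed ones to \<open>V y\<close>. Since \<open>W\<close> recovers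
    \<open>t\<close> from \<open>\<phi> t\<close>, the entry sum of \<open>\<bar>W\<bar>\<close> in
    \<open>c\<close> yields \<open>coord_bound\<close>; the 1 keeps \<open>c\<close>
    positive.\<close>
  define I where "I = {m..<n}"
  define a where "a i = (\<Sum>l<m. V $$ (i, l) * p' $ l)" for i
  define c where "c = nat (1 + (\<Sum>j<n. \<Sum>i<n. \<bar>W $$ (j, i)\<bar>))"
  define y where "y t = vec n (\<lambda>i. if i < m then p' $ i else t i)" for t :: "nat \<Rightarrow> int"
  define \<phi> where "\<phi> t = V *\<^sub>v y t" for t
  let ?B = "\<lambda>i j. V $$ (i, j)"
  have y_carrier: "y t \<in> carrier_vec n" for t
    by (simp add: y_def)
  have \<phi>_carrier: "\<phi> t \<in> carrier_vec n" for t
    using Vc y_carrier by (simp add: \<phi>_def)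
  have W\<phi>: "W *\<^sub>v \<phi> t = y t" for t
    unfolding \<phi>_def by (rule mult_mat_vec_inverse[OF W(1) Vc WV y_carrier])
  have \<phi>_entry: "\<phi> t $ i = a i + (\<Sum>j\<in>I. ?B i j * t j)" if i: "i < n" for t i
  proof -
    have "\<phi> t $ i = (\<Sum>j = 0..<n. V $$ (i, j) * y t $ j)"
      using i Vc y_carrier[of t] by (simp add: \<phi>_def scalar_prod_def)
    also have "\<dots> = (\<Sum>j = 0..<m. V $$ (i, j) * y t $ j) + (\<Sum>j = m..<n. V $$ (i, j) * y t $ j)"
      using mn by (simp add: sum.atLeastLessThan_concat)
    also have "(\<Sum>j = 0..<m. V $$ (i, j) * y t $ j) = a i"
      unfolding a_def lessThan_atLeast0 using mn by (intro sum.cong) (auto simp: y_def)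
    also have "(\<Sum>j = m..<n. V $$ (i, j) * y t $ j) = (\<Sum>j\<in>I. ?B i j * t j)"
      unfolding I_def by (intro sum.cong) (auto simp: y_def)
    finally show ?thesis .
  qed
  interpret affine_slice I "{..<n}" a ?B c
  proof
    show "finite I" "finite {..<n}"
      by (simp_all add: I_def)
    show "c > 0"
      unfolding c_def by (simp add: add_pos_nonneg sum_nonneg)
    fix t R j
    assume bound: "\<forall>i\<in>{..<n}. \<bar>a i + (\<Sum>j\<in>I. ?B i j * t j)\<bar> \<le> int R" and j: "j \<in> I"
    have jn: "j < n" and "y t $ j = t j"
      using j by (auto simp: I_def y_def)
    then have "t j = (W *\<^sub>v \<phi> t) $ j"
      by (simp add: W\<phi>)
    also have "\<dots> = (\<Sum>i<n. W $$ (j, i) * \<phi> t $ i)"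
      using jn W(1) \<phi>_carrier[of t] by (simp add: scalar_prod_def lessThan_atLeast0)
    finally have "\<bar>t j\<bar> \<le> (\<Sum>i<n. \<bar>W $$ (j, i)\<bar> * \<bar>\<phi> t $ i\<bar>)"
      using sum_abs[of "\<lambda>i. W $$ (j, i) * \<phi> t $ i" "{..<n}"] by (simp add: abs_mult)
    also have "\<dots> \<le> (\<Sum>i<n. \<bar>W $$ (j, i)\<bar> * int R)"
      using bound by (intro sum_mono mult_left_mono) (auto simp: \<phi>_entry)
    also have "\<dots> = (\<Sum>i<n. \<bar>W $$ (j, i)\<bar>) * int R"
      by (simp add: sum_distrib_right)
    also have "\<dots> \<le> (\<Sum>j<n. \<Sum>i<n. \<bar>W $$ (j, i)\<bar>) * int R"
      using jn by (intro mult_right_mono member_le_sum) (auto intro: sum_nonneg)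
    also have "\<dots> \<le> int c * int R"
      unfolding c_def by (intro mult_right_mono) (auto simp: sum_nonneg)
    finally show "\<bar>t j\<bar> \<le> int (c * R)"
      by simp
  qed
  have x_eq: "x t i = \<phi> t $ i" if "i < n" for t i
    using \<phi>_entry[OF that] by (simp add: x_def)
  have on_H: "real_vec z \<in> hyperplane_intersection n A p \<longleftrightarrow> (\<forall>i<m. (W *\<^sub>v z) $ i = p' $ i)"
    if "z \<in> carrier_vec n" for z
    unfolding hyperplane_intersection_iff[OF A p that] smith_coordinates_iff[OF A U Vc W(1) VW D snf that p]
    by (simp add: m p')
  have lattice: "lattice_points n (hyperplane_intersection n A p) r = \<phi> ` box (nat \<lfloor>r\<rfloor>)"
    if r: "r \<ge> 0" for r
  proof -
    \<comment> \<open>Integer coordinates only see the floor of the radius; \<open>r \<ge> 0\<close>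
      keeps \<open>nat\<close> from altering it.\<close>
    have in_range: "real_of_int z \<in> {- r..r} \<longleftrightarrow> \<bar>z\<bar> \<le> int (nat \<lfloor>r\<rfloor>)" for z
      using r by (auto simp: abs_le_iff le_floor_iff)
    show ?thesis
    proof (intro equalityI subsetI)
      fix z assume "z \<in> lattice_points n (hyperplane_intersection n A p) r"
      then have z: "z \<in> carrier_vec n" "\<forall>i<m. (W *\<^sub>v z) $ i = p' $ i" "\<forall>i<n. \<bar>z $ i\<bar> \<le> int (nat \<lfloor>r\<rfloor>)"
        using on_H in_range by (auto simp: lattice_points_def)
      define t where "t = restrict (\<lambda>j. (W *\<^sub>v z) $ j) I"
      have "y t = W *\<^sub>v z"
        using z(2) W(1) by (intro eq_vecI) (auto simp: y_def t_def I_def)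
      then have \<phi>t: "\<phi> t = z"
        unfolding \<phi>_def using mult_mat_vec_inverse[OF Vc W(1) VW z(1)] by simp
      then have "t \<in> box (nat \<lfloor>r\<rfloor>)"
        using z(3) by (auto simp: box_def x_eq t_def)
      with \<phi>t show "z \<in> \<phi> ` box (nat \<lfloor>r\<rfloor>)" by blast
    next
      fix z assume "z \<in> \<phi> ` box (nat \<lfloor>r\<rfloor>)"
      then obtain t where t: "t \<in> box (nat \<lfloor>r\<rfloor>)" "z = \<phi> t" by blast
      have "\<forall>i<n. real_of_int (\<phi> t $ i) \<in> {- r..r}"
        using t(1) unfolding in_range by (auto simp: box_def x_eq)
      moreover have "real_vec (\<phi> t) \<in> hyperplane_intersection n A p"
        unfolding on_H[OF \<phi>_carrier] W\<phi> using mn by (auto simp: y_def)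
      ultimately show "z \<in> lattice_points n (hyperplane_intersection n A p) r"
        using t(2) \<phi>_carrier[of t] by (auto simp: lattice_points_def)
    qed
  qed
  have vis_iff_visible: "visible (\<phi> t) \<longleftrightarrow> gcd (Gcd {p' $ i | i. i < m}) (Gcd (t ` I)) = 1" for t
  proof -
    have "{y t $ i | i. i < n} = {p' $ i | i. i < m} \<union> t ` I"
    proof (intro equalityI subsetI)
      fix v assume "v \<in> {p' $ i | i. i < m} \<union> t ` I"
      then show "v \<in> {y t $ i | i. i < n}"
      proof
        assume "v \<in> {p' $ i | i. i < m}"
        then obtain i where "i < m" "v = p' $ i" by blast
        then have "i < n" "v = y t $ i"
          using mn by (simp_all add: y_def)
        then show ?thesis by blast
      next
        assume "v \<in> t ` I"
        then obtain j where "j \<in> I" "v = t j" by blast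
        then have "j < n" "v = y t $ j"
          by (simp_all add: I_def y_def)
        then show ?thesis by blast
      qed
    qed (auto simp: y_def I_def)
    then show ?thesis
      unfolding \<phi>_def visible_unimodular_iff[OF Vc W(1) WV y_carrier] by (simp add: Gcd_int_Un)
  qed
  \<comment> \<open>\<open>W\<close> recovers \<open>y t\<close>, hence \<open>t\<close> on
    \<open>I\<close>, and box elements are determined by their values on \<open>I\<close>.\<close>
  have inj: "inj_on \<phi> (box R)" for R
  proof (rule inj_onI)
    fix t u assume t: "t \<in> box R" and u: "u \<in> box R" and "\<phi> t = \<phi> u"
    then have "y t = y u"
      by (metis W\<phi>)
    then have "y t $ j = y u $ j" for j
      by simp
    moreover have "y w $ j = w j" if "j \<in> I" for w j
      using that by (simp add: y_def I_def)
    ultimately have "t j = u j" if "j \<in> I" for j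
      using that by metis
    then show "t = u"
      using t u unfolding box_def by (blast intro: PiE_ext)
  qed
  \<comment> \<open>For \<open>m = 0\<close> this is the gcd of the empty set, namely 0, so all
    primes occur in the product.\<close>
  let ?g = "Gcd {p' $ i | i. i < m}"
  have card_lattice: "card (lattice_points n (hyperplane_intersection n A p) r) = card (box (nat \<lfloor>r\<rfloor>))"
    if "r \<ge> 0" for r
    unfolding lattice[OF that] by (rule card_image[OF inj])
  have card_visible: "card (visible_points n (hyperplane_intersection n A p) r) = card (vis ?g (nat \<lfloor>r\<rfloor>))"
    if "r \<ge> 0" for r
  proof -
    have "visible_points n (hyperplane_intersection n A p) r = \<phi> ` vis ?g (nat \<lfloor>r\<rfloor>)"
      unfolding visible_points_def lattice[OF that] vis_def by (auto simp: vis_iff_visible)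
    moreover have "inj_on \<phi> (vis ?g (nat \<lfloor>r\<rfloor>))"
      by (rule inj_on_subset[OF inj]) (auto simp: vis_def)
    ultimately show ?thesis
      by (simp add: card_image)
  qed
  have "((\<lambda>r. real (card (vis ?g (nat \<lfloor>r\<rfloor>))) / real (card (box (nat \<lfloor>r\<rfloor>))))
      \<longlongrightarrow> euler_product ?g (card I)) at_top"
    by (rule filterlim_compose[OF vis_density
          filterlim_compose[OF filterlim_nat_sequentially filterlim_floor_sequentially]])
  moreover have "card I = n - m"
    by (simp add: I_def)
  \<comment> \<open>The counts were identified for \<open>r \<ge> 0\<close> only, which suffices for
    the limit at infinity.\<close>
  moreover have "\<forall>\<^sub>F r in at_top. real (card (vis ?g (nat \<lfloor>r\<rfloor>))) / real (card (box (nat \<lfloor>r\<rfloor>)))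
      = real (card (visible_points n (hyperplane_intersection n A p) r))
        / real (card (lattice_points n (hyperplane_intersection n A p) r))"
    using eventually_ge_at_top[of 0] by eventually_elim (simp add: card_lattice card_visible)
  ultimately show ?thesis
    unfolding has_visible_density_def using tendsto_cong by force
qed

end
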